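(* Let $d\ge 1$, $\mu \in \mathbb{R}^d$, $a_X, a_Y \in \mathbb{R}^d$, $\sigma_X^2,\sigma_Y^2,\tau^2>0$, and let $\mathcal{L}_1,\mathcal{L}_2$ be cdfs on $\mathbb{R}$, where $\mathcal{L}_1$ has density $g$. (a) For $X|\theta \sim MMN_d(\theta, a_X, \sigma_X^2 I_d, \mathcal{L}_1)$ and $Y|\theta \sim MMN_d(\theta, a_Y, \sigma_Y^2 I_d, \mathcal{L}_2)$ independent given $\theta$, with prior $\theta \sim N_d(\mu, \tau^2 I_d)$, the Bayes predictive density for $Y$ (the conditional density of $Y$ given $X=x$) is that of a $$ MMN_d\left(\omega x + (1-\omega)\mu,\; -\omega a_X,\; a_Y,\; (\omega\sigma_X^2 + \sigma_Y^2) I_d,\; \mathcal{L}\right) $$ distribution, with $\omega = \tau^2/(\tau^2+\sigma_X^2)$ and $\mathcal{L}$ the joint cdf of $(K',J')$, where $K'$ and $J'$ are independent, $J' \sim \mathcal{L}_2$, and $K'$ has density $$ g_{\pi,x}(k') \propto g(k')\, e^{-\frac{A}{2} k'^2 + B k'}, \quad A = \frac{\|a_X\|^2}{\sigma_X^2+\tau^2}, \quad B = \frac{(x-\mu)^\top a_X}{\sigma_X^2+\tau^2}. $$ (b) Moreover, whenever $a_Y = c\, a_X$ for $a_X \neq 0$ and a fixed $c \in \mathbb{R}$, the Bayes predictive distribution of $Y$ given $X=x$, namely $MMN_d\left(\omega x + (1-\omega)\mu, -\omega a_X, a_Y, (\omega\sigma_X^2 + \sigma_Y^2) I_d, \mathcal{L}\right)$,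 is $MMN_d\left(\omega x + (1-\omega)\mu, a_X, (\omega\sigma_X^2+\sigma_Y^2) I_d, \mathcal{L}_3\right)$, with $\mathcal{L}_3$ the cdf of $cJ' - \omega K'$, where $K'$ and $J'$ are independent, $J' \sim \mathcal{L}_2$ and $K'$ has density $g_{\pi,x}$. Finally, for $a_X = 0$, i.e., for $X|\theta \sim N_d(\theta, \sigma_X^2 I_d)$, the predictive distribution is $MMN_d(\omega x + (1-\omega)\mu, a_Y, (\omega\sigma_X^2+\sigma_Y^2) I_d, \mathcal{L}_2)$.
   Context: A random vector $X \in \mathbb{R}^d$ has a mean-mixture of normal distributions, written $X \sim MMN_d(\theta, a, \Sigma, \mathcal{L})$, if $X|V=v \sim N_d(\theta + v a, \Sigma)$ with $V \sim \mathcal{L}$, where $\theta\in\mathbb{R}^d$, $a \in \mathbb{R}^d$, $\Sigma$ is positive definite, and $V$ is a scalar random variable with cdf $\mathcal{L}$ (for $a=0$ this is simply $N_d(\theta,\Sigma)$). A random vector $Z \in \mathbb{R}^d$ has a mean mixture of normal distributions with two directions, written $Z \sim MMN_d(\theta, a_1, a_2, \Sigma, \mathcal{L})$, if $Z|W_1,W_2 \sim N_d(\theta + a_1 W_1 + a_2 W_2, \Sigma)$ with $(W_1,W_2) \sim \mathcal{L}$, where $\theta, a_1, a_2 \in \mathbb{R}^d$, $\Sigma$ is positive definite, and $W_1,W_2$ are scalar random variables with joint cdf $\mathcal{L}$. The density $g$ of $\mathcal{L}_1$ and the density $g_{\pi,x}$ are taken with respect to the same dominating measure on $\mathbb{R}$.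 *)

theory Defs
  imports "HOL-Probability.Probability"
begin

(* Distributions are represented by their laws (measures on borel) rather than by cdfs. *)

definition mvn_density :: "real^'n \<Rightarrow> real^'n^'n \<Rightarrow> real^'n \<Rightarrow> real" where
  "mvn_density m S x =
     exp (- ((x - m) \<bullet> (matrix_inv S *v (x - m))) / 2) / sqrt ((2 * pi) ^ CARD('n) * det S)"

(* Meaningful for positive definite S only; the same holds for the mixtures below. *)
definition mvn :: "real^'n \<Rightarrow> real^'n^'n \<Rightarrow> (real^'n) measure" where
  "mvn m S = density lborel (\<lambda>x. ennreal (mvn_density m S x))"

(* Law of X when X | V = v has law mvn (m + v a) S and V has law L. *)
definition mmn :: "real^'n \<Rightarrow> real^'n \<Rightarrow> real^'n^'n \<Rightarrow> real measure \<Rightarrow> (real^'n) measure" where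
  "mmn m a S L = L \<bind> (\<lambda>v. mvn (m + v *\<^sub>R a) S)"

definition mmn_density :: "real^'n \<Rightarrow> real^'n \<Rightarrow> real^'n^'n \<Rightarrow> real measure \<Rightarrow> real^'n \<Rightarrow> real" where
  "mmn_density m a S L x = (\<integral>v. mvn_density (m + v *\<^sub>R a) S x \<partial>L)"

(* Law of Z when Z | (W1, W2) = (w1, w2) has law mvn (m + w1 a1 + w2 a2) S and (W1, W2) has law L. *)
definition mmn2 ::
  "real^'n \<Rightarrow> real^'n \<Rightarrow> real^'n \<Rightarrow> real^'n^'n \<Rightarrow> (real \<times> real) measure \<Rightarrow> (real^'n) measure" where
  "mmn2 m a1 a2 S L = L \<bind> (\<lambda>(w1, w2). mvn (m + w1 *\<^sub>R a1 + w2 *\<^sub>R a2) S)"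

(* k is a regular conditional distribution of Y given X, i.e. Y | X = x has law k x:
   P(X in A, Y in B) is the integral of k x B over x in A against the law of X. *)
definition has_cond_distr ::
  "'w measure \<Rightarrow> ('w \<Rightarrow> 'a) \<Rightarrow> 'a measure \<Rightarrow> ('w \<Rightarrow> 'b) \<Rightarrow> 'b measure \<Rightarrow> ('a \<Rightarrow> 'b measure) \<Rightarrow> bool" where
  "has_cond_distr M X MX Y MY k \<longleftrightarrow>
     X \<in> measurable M MX \<and> Y \<in> measurable M MY \<and> k \<in> measurable MX (prob_algebra MY) \<and>
     (\<forall>A\<in>sets MX. \<forall>B\<in>sets MY.
        emeasure M {w \<in> space M. X w \<in> A \<and> Y w \<in> B} =
        (\<integral>\<^sup>+x\<in>A. emeasure (k x) B \<partial>distr M MX X))"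

(* Conditional density of Y given X = x, as the joint density of (X, Y) divided by the marginal
   density of X, when p t and q t are the densities of X and Y given the parameter value t,
   X and Y are independent given the parameter, and the parameter has law prior. *)
definition bayes_predictive_density ::
  "'t measure \<Rightarrow> ('t \<Rightarrow> 'a \<Rightarrow> real) \<Rightarrow> ('t \<Rightarrow> 'b \<Rightarrow> real) \<Rightarrow> 'a \<Rightarrow> 'b \<Rightarrow> real" where
  "bayes_predictive_density prior p q x y =
     (\<integral>t. p t x * q t y \<partial>prior) / (\<integral>t. p t x \<partial>prior)"

(* The probability density with respect to N proportional to h. *)
definition normalized_density :: "'a measure \<Rightarrow> ('a \<Rightarrow> real) \<Rightarrow> 'a \<Rightarrow> real" where
  "normalized_density N h k = h k / (\<integral>u. h u \<partial>N)"

end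

theory Submission
  imports Defs
begin

text \<open>
  Every covariance matrix involved is a multiple of the identity, so a single family of densities
  suffices: \<open>\<phi>\<^sub>s(z) = isotropic_normal s z\<close>, the density of the centred normal law with covariance
  \<open>s\<close> times the identity. Write \<open>s\<close>, \<open>r\<close>, \<open>t\<close> for the variances of \<open>X\<close>, of \<open>Y\<close> and of the prior.

  Condition on the values \<open>v\<close> and \<open>w\<close> of the mixing variables of \<open>X\<close> and \<open>Y\<close>. The model is then the
  conjugate normal one for the shifted observation \<open>x - v aX\<close>. Completing the square
  (\<open>isotropic_normal_mult\<close>) splits \<open>\<phi>\<^sub>s(x - v aX - \<theta>) \<phi>\<^sub>t(\<theta> - \<mu>)\<close> into the marginal
  \<open>\<phi>\<^bsub>s+t\<^esub>(x - v aX - \<mu>)\<close>, which is free of \<open>\<theta>\<close>, and a normal posterior of \<open>\<theta>\<close> with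
  variance \<open>\<omega> s\<close> and mean \<open>\<omega> (x - v aX) + (1 - \<omega>) \<mu>\<close>; integrating the density of \<open>Y\<close> against it
  gives a normal density with variance \<open>\<omega> s + r\<close> (\<open>nn_integral_normal_conjugacy\<close>). Moving the argument
  of the marginal along \<open>aX\<close> multiplies it by \<open>exp (- A v\<^sup>2 / 2 + B v)\<close>
  (\<open>isotropic_normal_shift_eq_exp_tilt\<close>).

  Undoing the conditioning with Tonelli's theorem, numerator and denominator of the predictive density
  both carry the factor \<open>\<phi>\<^bsub>s+t\<^esub>(x - \<mu>)\<close>. It cancels, and what remains is the normal density with mean
  \<open>\<omega> x + (1 - \<omega>) \<mu> - \<omega> v aX + w aY\<close>, averaged over \<open>w\<close> with law \<open>L2\<close> and over \<open>v\<close> with law \<open>L1\<close>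
  tilted by \<open>exp (- A v\<^sup>2 / 2 + B v)\<close> and renormalized (\<open>mmn_bayes_predictive_density\<close>). That is the
  density of the two-direction mixture.

  That the predictive density is a version of the conditional law of \<open>Y\<close> given \<open>X\<close> is a fact about
  arbitrary densities: it is the quotient of a joint density by a positive marginal density
  (\<open>bayes_predictive_has_cond_distr\<close>). The special cases of collinear directions and of a vanishing
  direction follow because the mixture depends on its mixing variables only through the mean.
\<close>

section \<open>Isotropic normal densities\<close>

definition isotropic_normal :: "real \<Rightarrow> 'a::euclidean_space \<Rightarrow> real" where
  "isotropic_normal s z = exp (- (norm z)\<^sup>2 / (2 * s)) / sqrt ((2 * pi * s) ^ DIM('a))"

lemma isotropic_normal_pos: "s > 0 \<Longrightarrow> isotropic_normal s z > 0"
  by (simp add: isotropic_normal_def)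

lemma isotropic_normal_nonneg: "s > 0 \<Longrightarrow> isotropic_normal s z \<ge> 0"
  by (simp add: isotropic_normal_pos less_imp_le)

lemma isotropic_normal_le_mode:
  fixes z :: "'a::euclidean_space"
  shows "s > 0 \<Longrightarrow> isotropic_normal s z \<le> isotropic_normal s (0::'a)"
  by (simp add: isotropic_normal_def divide_right_mono)

lemma isotropic_normal_measurable [measurable]: "isotropic_normal s \<in> borel_measurable borel"
  unfolding isotropic_normal_def by measurable

text \<open>
  The coordinates are independent, which reduces the normalization below to the one-dimensional
  case.
\<close>

lemma isotropic_normal_eq_prod:
  fixes z :: "'a::euclidean_space"
  assumes "s > 0"
  shows "isotropic_normal s z = (\<Prod>b\<in>Basis. normal_density 0 (sqrt s) (z \<bullet> b))"
proof -
  have "(norm z)\<^sup>2 = (\<Sum>b\<in>Basis. (z \<bullet> b)\<^sup>2)"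
    unfolding power2_norm_eq_inner by (subst euclidean_inner) (simp add: power2_eq_square)
  then have exp_eq: "exp (- (norm z)\<^sup>2 / (2 * s)) = (\<Prod>b\<in>Basis. exp (- (z \<bullet> b)\<^sup>2 / (2 * s)))"
    by (simp add: exp_sum [symmetric] sum_negf sum_divide_distrib)
  have "(\<Prod>b\<in>(Basis::'a set). sqrt (2 * pi * s)) = sqrt ((2 * pi * s) ^ DIM('a))"
    by (simp only: prod_constant real_sqrt_power)
  then show ?thesis
    using assms unfolding isotropic_normal_def exp_eq
    by (simp add: normal_density_def prod_dividef)
qed

lemma nn_integral_isotropic_normal:
  fixes m :: "'a::euclidean_space"
  assumes "s > 0"
  shows "(\<integral>\<^sup>+x. isotropic_normal s (x - m) \<partial>lborel) = 1"
proof -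
  have "(\<integral>\<^sup>+x. isotropic_normal s (x - m) \<partial>lborel)
      = (\<integral>\<^sup>+x. (\<Prod>b\<in>Basis. ennreal (normal_density (m \<bullet> b) (sqrt s) (x \<bullet> b))) \<partial>lborel)"
    using assms
    by (simp add: isotropic_normal_eq_prod prod_ennreal normal_density_def inner_diff_left)
  also have "\<dots> = (\<Prod>b\<in>(Basis::'a set). \<integral>\<^sup>+x. ennreal (normal_density (m \<bullet> b) (sqrt s) x) \<partial>lborel)"
    by (subst nn_integral_lborel_prod) auto
  also have "\<dots> = 1"
    using assms by (simp add: nn_integral_eq_integral integrable_normal_density integral_normal_density)
  finally show ?thesis .
qed

text \<open>
  Completing the square in \<open>u\<close>: a normal prior with mean \<open>m\<close> and variance \<open>t\<close> combined with an
  observation \<open>a\<close> of variance \<open>s\<close> gives the marginal density of \<open>a\<close> times the posterior density of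
  \<open>u\<close>. The posterior mean weights \<open>a\<close> and \<open>m\<close> by the precisions \<open>1 / s\<close> and \<open>1 / t\<close>, and the
  posterior precision is \<open>1 / s + 1 / t\<close>.
\<close>

lemma isotropic_normal_mult:
  fixes a m u :: "'a::euclidean_space"
  assumes s: "s > 0" and t: "t > 0"
  shows "isotropic_normal s (a - u) * isotropic_normal t (u - m) =
    isotropic_normal (s + t) (a - m) *
    isotropic_normal (s * t / (s + t)) (u - ((t / (s + t)) *\<^sub>R a + (s / (s + t)) *\<^sub>R m))"
proof -
  define r where "r = s + t"
  have r: "r > 0" and t_eq: "t = r - s" using s t by (auto simp: r_def)
  \<comment> \<open>Both sides depend on \<open>a\<close>, \<open>u\<close>, \<open>m\<close> through differences only, so \<open>m\<close> may be taken as origin.\<close>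
  define e where "e = a - m"
  define v where "v = u - m"
  have 1: "a - u = e - v" by (simp add: e_def v_def)
  have "u - ((t / r) *\<^sub>R a + (s / r) *\<^sub>R m) = v - (t / r) *\<^sub>R e + (1 - t / r - s / r) *\<^sub>R m"
    by (simp add: v_def e_def algebra_simps)
  moreover have "1 - t / r - s / r = 0"
    using r by (simp add: t_eq field_simps)
  ultimately have 2: "u - ((t / r) *\<^sub>R a + (s / r) *\<^sub>R m) = v - (t / r) *\<^sub>R e" by simp
  have exponents: "(norm (e - v))\<^sup>2 / (2 * s) + (norm v)\<^sup>2 / (2 * t) =
    (norm e)\<^sup>2 / (2 * r) + (norm (v - (t / r) *\<^sub>R e))\<^sup>2 / (2 * (s * t / r))"
    using s t unfolding power2_norm_eq_inner r_def
    by (simp add: inner_diff_left inner_diff_right inner_commute[of e v] divide_simps add_pos_pos)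
       (simp add: algebra_simps power2_eq_square)
  have const: "(2 * pi * s) ^ DIM('a) * (2 * pi * t) ^ DIM('a) =
      (2 * pi * r) ^ DIM('a) * (2 * pi * (s * t / r)) ^ DIM('a)"
    unfolding power_mult_distrib [symmetric] using r by (intro arg_cong[of _ _ "\<lambda>z. z ^ _"]) simp
  have "- (norm (e - v))\<^sup>2 / (2 * s) + - (norm v)\<^sup>2 / (2 * t) =
    - (norm e)\<^sup>2 / (2 * r) + - (norm (v - (t / r) *\<^sub>R e))\<^sup>2 / (2 * (s * t / r))"
    using exponents by linarith
  then show ?thesis
    unfolding isotropic_normal_def r_def [symmetric] 1 2 e_def [symmetric] v_def [symmetric]
      times_divide_times_eq exp_add [symmetric] real_sqrt_mult [symmetric] const
    by (rule arg_cong)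
qed

text \<open>
  The posterior factor of \<open>isotropic_normal_mult\<close> integrates to one.
\<close>

lemma nn_integral_isotropic_normal_convolution:
  fixes a m :: "'a::euclidean_space"
  assumes s: "s > 0" and t: "t > 0"
  shows "(\<integral>\<^sup>+u. isotropic_normal s (a - u) * isotropic_normal t (u - m) \<partial>lborel) =
    isotropic_normal (s + t) (a - m)"
proof -
  have "s * t / (s + t) > 0" "s + t > 0" using s t by (simp_all add: add_pos_pos)
  then show ?thesis
    by (simp add: isotropic_normal_mult[OF s t] ennreal_mult isotropic_normal_nonneg nn_integral_cmult
        nn_integral_isotropic_normal)
qed

text \<open>
  Here \<open>a\<close> and \<open>b\<close> are observations of the same unknown \<open>u\<close>, which has a normal prior. Completing the
  square first for \<open>a\<close> replaces the prior by the posterior given \<open>a\<close>; completing it again for \<open>b\<close>, with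
  this posterior in the role of the prior, leaves the predictive density of \<open>b\<close> and a factor that
  integrates to one.
\<close>

lemma nn_integral_normal_conjugacy:
  fixes a b m :: "'a::euclidean_space"
  assumes s: "s > 0" and t: "t > 0" and r: "r > 0"
  defines "\<omega> \<equiv> t / (t + s)"
  shows "(\<integral>\<^sup>+u. isotropic_normal s (a - u) * isotropic_normal r (b - u) * isotropic_normal t (u - m) \<partial>lborel) =
    isotropic_normal (s + t) (a - m) *
    isotropic_normal (\<omega> * s + r) (b - (\<omega> *\<^sub>R a + (1 - \<omega>) *\<^sub>R m))"
proof -
  define c where "c = \<omega> *\<^sub>R a + (1 - \<omega>) *\<^sub>R m"
  have \<omega>': "1 - \<omega> = s / (s + t)" "\<omega> = t / (s + t)" and \<omega>s: "\<omega> * s > 0" "\<omega> * s = s * t / (s + t)"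
    using s t by (simp_all add: \<omega>_def field_simps)
  define c' where "c' = ((\<omega> * s / (r + \<omega> * s)) *\<^sub>R b + (r / (r + \<omega> * s)) *\<^sub>R c)"
  have prod: "isotropic_normal s (a - u) * isotropic_normal r (b - u) * isotropic_normal t (u - m) =
      isotropic_normal (s + t) (a - m) * isotropic_normal (\<omega> * s + r) (b - c) *
      isotropic_normal (r * (\<omega> * s) / (r + \<omega> * s)) (u - c')" for u
  proof -
    have "isotropic_normal s (a - u) * isotropic_normal r (b - u) * isotropic_normal t (u - m) =
       isotropic_normal (s + t) (a - m) * (isotropic_normal r (b - u) * isotropic_normal (\<omega> * s) (u - c))"
      using isotropic_normal_mult[OF s t, of a u m] unfolding c_def \<omega>s(2) \<omega>'(1)
      by (simp add: \<omega>'(2) mult.assoc mult.left_commute[of _ "isotropic_normal r _"])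
    also have "isotropic_normal r (b - u) * isotropic_normal (\<omega> * s) (u - c) =
       isotropic_normal (\<omega> * s + r) (b - c) * isotropic_normal (r * (\<omega> * s) / (r + \<omega> * s)) (u - c')"
      using isotropic_normal_mult[OF r \<omega>s(1), of b u c] by (simp add: c'_def add.commute)
    finally show ?thesis by (simp add: mult.assoc)
  qed
  have "r * (\<omega> * s) / (r + \<omega> * s) > 0"
    by (intro divide_pos_pos mult_pos_pos[OF r \<omega>s(1)] add_pos_pos[OF r \<omega>s(1)])
  moreover have "s + t > 0" "\<omega> * s + r > 0" using s t r \<omega>s by (simp_all add: add_pos_pos)
  ultimately show ?thesis
    by (simp add: prod ennreal_mult isotropic_normal_nonneg nn_integral_cmult nn_integral_isotropic_normal c_def)
qed

text \<open>
  The weight by which the law of the mixing variable changes once \<open>X\<close> has been observed. Its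
  exponent is what a shift along a direction adds to the exponent of a normal density.
\<close>

definition exp_tilt :: "real \<Rightarrow> real \<Rightarrow> real \<Rightarrow> real" where
  "exp_tilt A B k = exp (- A / 2 * k\<^sup>2 + B * k)"

lemma exp_tilt_measurable [measurable]: "exp_tilt A B \<in> borel_measurable borel"
  unfolding exp_tilt_def by measurable

lemma exp_tilt_pos: "exp_tilt A B k > 0"
  by (simp add: exp_tilt_def)

lemma exp_tilt_nonneg: "exp_tilt A B k \<ge> 0"
  by (simp add: exp_tilt_def)

lemma isotropic_normal_shift_eq_exp_tilt:
  fixes z a :: "'a::euclidean_space"
  assumes "s > 0"
  shows "isotropic_normal s (z - v *\<^sub>R a) =
    isotropic_normal s z * exp_tilt ((norm a)\<^sup>2 / s) ((z \<bullet> a) / s) v"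
proof -
  have "- (norm (z - v *\<^sub>R a))\<^sup>2 / (2 * s) =
     - (norm z)\<^sup>2 / (2 * s) + (- ((norm a)\<^sup>2 / s) / 2 * v\<^sup>2 + (z \<bullet> a) / s * v)"
    using assms unfolding power2_norm_eq_inner
    by (simp add: inner_diff_left inner_diff_right inner_commute[of a z] field_simps power2_eq_square)
  then show ?thesis
    unfolding isotropic_normal_def exp_tilt_def times_divide_eq_left exp_add [symmetric] by (rule arg_cong)
qed

lemma integrable_isotropic_normal_mixture:
  fixes h :: "'v \<Rightarrow> 'a::euclidean_space"
  assumes "prob_space L" "h \<in> borel_measurable L" "s > 0"
  shows "integrable L (\<lambda>v. isotropic_normal s (h v))"
proof -
  interpret prob_space L by fact
  show ?thesis
    using assms
    by (intro integrable_const_bound[where B = "isotropic_normal s (0::'a)"])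
      (auto simp: isotropic_normal_nonneg isotropic_normal_le_mode)
qed

section \<open>Mixtures of laws with densities\<close>

text \<open>
  Monadic composition and regular conditional distributions both ask for kernels that are measurable
  in this sense; joint measurability of the densities gives it by Tonelli's theorem.
\<close>

lemma density_kernel_measurable:
  fixes f :: "'v \<Rightarrow> 'a::euclidean_space \<Rightarrow> real"
  assumes f [measurable]: "(\<lambda>(v, x). f v x) \<in> borel_measurable (N \<Otimes>\<^sub>M borel)"
    and one: "\<And>v. v \<in> space N \<Longrightarrow> (\<integral>\<^sup>+x. f v x \<partial>lborel) = 1"
  shows "(\<lambda>v. density lborel (\<lambda>x. ennreal (f v x))) \<in> measurable N (prob_algebra borel)"
proof (rule measurable_prob_algebraI)
  show prob: "prob_space (density lborel (\<lambda>x. ennreal (f v x)))" if "v \<in> space N" for v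
    using one[OF that] that by (intro prob_spaceI) (simp add: emeasure_density cong: nn_integral_cong)
  show "(\<lambda>v. density lborel (\<lambda>x. ennreal (f v x))) \<in> measurable N (subprob_algebra borel)"
  proof (rule measurable_subprob_algebra)
    fix S :: "'a set" assume [measurable]: "S \<in> sets borel"
    have "(\<lambda>v. \<integral>\<^sup>+x. ennreal (f v x) * indicator S x \<partial>lborel) \<in> borel_measurable N"
      by measurable
    then show "(\<lambda>v. emeasure (density lborel (\<lambda>x. ennreal (f v x))) S) \<in> borel_measurable N"
      by (rule measurable_cong[THEN iffD1, rotated]) (simp add: emeasure_density)
  qed (auto simp: prob prob_space_imp_subprob_space)
qed

text \<open>
  Tonelli's theorem: the mixture of laws with densities has the mixture of the densities as density.
\<close>

lemma bind_density_lborel: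
  fixes f :: "'v \<Rightarrow> 'a::euclidean_space \<Rightarrow> real"
  assumes L: "prob_space L"
    and f [measurable]: "(\<lambda>(v, x). f v x) \<in> borel_measurable (L \<Otimes>\<^sub>M borel)"
    and one: "\<And>v. v \<in> space L \<Longrightarrow> (\<integral>\<^sup>+x. f v x \<partial>lborel) = 1"
  shows "L \<bind> (\<lambda>v. density lborel (\<lambda>x. ennreal (f v x))) =
    density lborel (\<lambda>x. \<integral>\<^sup>+v. f v x \<partial>L)"
proof (rule measure_eqI)
  interpret prob_space L by fact
  interpret pair_sigma_finite L "lborel :: 'a measure" ..
  have kernel: "(\<lambda>v. density lborel (\<lambda>x. ennreal (f v x))) \<in> measurable L (subprob_algebra borel)"
    by (rule measurable_prob_algebraD[OF density_kernel_measurable[OF f one]])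
  show sets: "sets (L \<bind> (\<lambda>v. density lborel (\<lambda>x. ennreal (f v x)))) =
      sets (density lborel (\<lambda>x. \<integral>\<^sup>+v. f v x \<partial>L))"
    using not_empty by simp
  fix S assume "S \<in> sets (L \<bind> (\<lambda>v. density lborel (\<lambda>x. ennreal (f v x))))"
  then have [measurable]: "S \<in> sets borel" by (simp add: sets)
  have "emeasure (L \<bind> (\<lambda>v. density lborel (\<lambda>x. ennreal (f v x)))) S =
      (\<integral>\<^sup>+v. \<integral>\<^sup>+x. ennreal (f v x) * indicator S x \<partial>lborel \<partial>L)"
    by (subst emeasure_bind[OF not_empty kernel])
      (auto simp: emeasure_density intro!: nn_integral_cong)
  also have "\<dots> = (\<integral>\<^sup>+x. \<integral>\<^sup>+v. ennreal (f v x) * indicator S x \<partial>L \<partial>lborel)"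
    by (rule Fubini'[symmetric]) measurable
  also have "\<dots> = emeasure (density lborel (\<lambda>x. \<integral>\<^sup>+v. f v x \<partial>L)) S"
    by (simp add: emeasure_density nn_integral_multc)
  finally show "emeasure (L \<bind> (\<lambda>v. density lborel (\<lambda>x. ennreal (f v x)))) S =
      emeasure (density lborel (\<lambda>x. \<integral>\<^sup>+v. f v x \<partial>L)) S" .
qed

section \<open>Predictive densities and conditional distributions\<close>

text \<open>
  By Tonelli, \<open>X\<close> has density \<open>m x = \<integral> p t x dprior\<close> and \<open>(X, Y)\<close> has density
  \<open>f x y = \<integral> p t x q t y dprior\<close>. The predictive density is \<open>f / m\<close>, and \<open>m\<close> is positive everywhere, so
  integrating it against the law of \<open>X\<close> restores \<open>f\<close>. The integrability assumptions make the
  integrals in its definition agree with the corresponding extended nonnegative integrals.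
\<close>

lemma bayes_predictive_has_cond_distr:
  fixes X :: "'w \<Rightarrow> 'a::euclidean_space" and Y :: "'w \<Rightarrow> 'b::euclidean_space"
    and p :: "'t \<Rightarrow> 'a \<Rightarrow> real" and q :: "'t \<Rightarrow> 'b \<Rightarrow> real"
  assumes M: "prob_space M"
    and model: "has_cond_distr M T N (\<lambda>w. (X w, Y w)) (borel \<Otimes>\<^sub>M borel)
      (\<lambda>t. density lborel (p t) \<Otimes>\<^sub>M density lborel (q t))"
    and prior: "distr M N T = prior"
    and p [measurable]: "(\<lambda>(t, x). p t x) \<in> borel_measurable (N \<Otimes>\<^sub>M borel)"
    and q [measurable]: "(\<lambda>(t, y). q t y) \<in> borel_measurable (N \<Otimes>\<^sub>M borel)"
    and p_nonneg: "\<And>t x. p t x \<ge> 0" and q_nonneg: "\<And>t y. q t y \<ge> 0"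
    and p_one: "\<And>t. t \<in> space N \<Longrightarrow> (\<integral>\<^sup>+x. p t x \<partial>lborel) = 1"
    and q_one: "\<And>t. t \<in> space N \<Longrightarrow> (\<integral>\<^sup>+y. q t y \<partial>lborel) = 1"
    and p_int: "\<And>x. integrable prior (\<lambda>t. p t x)"
    and pq_int: "\<And>x y. integrable prior (\<lambda>t. p t x * q t y)"
    and p_pos: "\<And>x. (\<integral>t. p t x \<partial>prior) > 0"
  shows "has_cond_distr M X borel Y borel
    (\<lambda>x. density lborel (\<lambda>y. ennreal (bayes_predictive_density prior p q x y)))"
proof -
  interpret M: prob_space M by fact
  have T [measurable]: "T \<in> measurable M N"
    and XY [measurable]: "(\<lambda>w. (X w, Y w)) \<in> measurable M (borel \<Otimes>\<^sub>M borel)"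
    using model by (auto simp: has_cond_distr_def)
  have X [measurable]: "X \<in> borel_measurable M"
    using measurable_compose[OF XY measurable_fst] by simp
  have Y [measurable]: "Y \<in> borel_measurable M"
    using measurable_compose[OF XY measurable_snd] by simp
  have sets_prior [measurable_cong, simp]: "sets prior = sets N" and space_prior: "space prior = space N"
    by (simp_all add: prior [symmetric])
  interpret prior: prob_space prior
    unfolding prior [symmetric] by (rule M.prob_space_distr) measurable
  interpret PA: pair_sigma_finite prior "lborel :: 'a measure" ..
  interpret PB: pair_sigma_finite prior "lborel :: 'b measure" ..
  define m where "m x = (\<integral>t. p t x \<partial>prior)" for x
  define f where "f x y = (\<integral>t. p t x * q t y \<partial>prior)" for x y
  have m_pos: "m x > 0" for x using p_pos by (simp add: m_def)
  have f_nonneg: "f x y \<ge> 0" for x y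
    unfolding f_def by (intro Bochner_Integration.integral_nonneg) (simp add: p_nonneg q_nonneg)
  have m_eq: "ennreal (m x) = (\<integral>\<^sup>+t. p t x \<partial>prior)" for x
    unfolding m_def by (intro nn_integral_eq_integral [symmetric] p_int) (simp add: p_nonneg)
  have f_eq: "ennreal (f x y) = (\<integral>\<^sup>+t. ennreal (p t x) * ennreal (q t y) \<partial>prior)" for x y
    unfolding f_def ennreal_mult[OF p_nonneg q_nonneg, symmetric]
    by (intro nn_integral_eq_integral [symmetric] pq_int) (simp add: p_nonneg q_nonneg)
  have m_meas [measurable]: "m \<in> borel_measurable borel"
    unfolding m_def by measurable
  have f_meas [measurable]: "(\<lambda>(x, y). f x y) \<in> borel_measurable (borel \<Otimes>\<^sub>M borel)"
    unfolding f_def by measurable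
  have joint: "emeasure M {w \<in> space M. X w \<in> A \<and> Y w \<in> B} =
      (\<integral>\<^sup>+t. (\<integral>\<^sup>+x\<in>A. p t x \<partial>lborel) * (\<integral>\<^sup>+y\<in>B. q t y \<partial>lborel) \<partial>prior)"
    if [measurable]: "A \<in> sets borel" "B \<in> sets borel" for A B
  proof -
    have "emeasure M {w \<in> space M. X w \<in> A \<and> Y w \<in> B} =
        emeasure M {w \<in> space M. T w \<in> space N \<and> (X w, Y w) \<in> A \<times> B}"
      using measurable_space[OF T] by (intro arg_cong[of _ _ "emeasure M"]) auto
    also have "\<dots> = (\<integral>\<^sup>+t\<in>space N. emeasure (density lborel (p t) \<Otimes>\<^sub>M density lborel (q t)) (A \<times> B) \<partial>prior)"
    proof -
      have "A \<times> B \<in> sets (borel \<Otimes>\<^sub>M borel)" by measurable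
      with model show ?thesis
        unfolding has_cond_distr_def prior by blast
    qed
    also have "\<dots> = (\<integral>\<^sup>+t. (\<integral>\<^sup>+x\<in>A. p t x \<partial>lborel) * (\<integral>\<^sup>+y\<in>B. q t y \<partial>lborel) \<partial>prior)"
    proof (rule nn_integral_cong)
      fix t assume "t \<in> space prior"
      then have t: "t \<in> space N" by (simp add: space_prior)
      interpret Q: prob_space "density lborel (\<lambda>y. ennreal (q t y))"
        using q_one[OF t] t by (intro prob_spaceI) (simp add: emeasure_density cong: nn_integral_cong)
      show "emeasure (density lborel (p t) \<Otimes>\<^sub>M density lborel (q t)) (A \<times> B) * indicator (space N) t =
          (\<integral>\<^sup>+x\<in>A. p t x \<partial>lborel) * (\<integral>\<^sup>+y\<in>B. q t y \<partial>lborel)"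
        using t by (simp add: Q.emeasure_pair_measure_Times emeasure_density)
    qed
    finally show ?thesis .
  qed
  have X_law: "distr M borel X = density lborel m"
  proof (rule measure_eqI)
    fix A assume "A \<in> sets (distr M borel X)"
    then have [measurable]: "A \<in> sets borel" by simp
    have "emeasure (distr M borel X) A = emeasure M {w \<in> space M. X w \<in> A \<and> Y w \<in> UNIV}"
      by (auto simp: emeasure_distr intro!: arg_cong[of _ _ "emeasure M"])
    also have "\<dots> = (\<integral>\<^sup>+t. (\<integral>\<^sup>+x\<in>A. p t x \<partial>lborel) \<partial>prior)"
      by (subst joint) (auto intro!: nn_integral_cong simp: q_one space_prior)
    also have "\<dots> = (\<integral>\<^sup>+x. (\<integral>\<^sup>+t. ennreal (p t x) * indicator A x \<partial>prior) \<partial>lborel)"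
      by (rule PA.Fubini' [symmetric]) measurable
    also have "\<dots> = emeasure (density lborel m) A"
      by (simp add: emeasure_density nn_integral_multc m_eq)
    finally show "emeasure (distr M borel X) A = emeasure (density lborel m) A" .
  qed simp
  \<comment> \<open>Multiplying by the density of \<open>X\<close> undoes the division in the predictive density.\<close>
  have ratio: "ennreal (m x) * ennreal (f x y / m x) = ennreal (f x y)" for x y
    using m_pos[of x] f_nonneg[of x y] by (simp add: ennreal_mult [symmetric])
  have f_one: "(\<integral>\<^sup>+y. ennreal (f x y) \<partial>lborel) = ennreal (m x)" for x
  proof -
    have "(\<integral>\<^sup>+y. ennreal (f x y) \<partial>lborel) = (\<integral>\<^sup>+t. (\<integral>\<^sup>+y. ennreal (p t x) * ennreal (q t y) \<partial>lborel) \<partial>prior)"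
      unfolding f_eq by (rule PB.Fubini') measurable
    also have "\<dots> = (\<integral>\<^sup>+t. ennreal (p t x) \<partial>prior)"
      by (intro nn_integral_cong) (simp add: space_prior nn_integral_cmult q_one)
    finally show ?thesis by (simp add: m_eq)
  qed
  have pred_eq: "bayes_predictive_density prior p q x y = f x y / m x" for x y
    by (simp add: bayes_predictive_density_def f_def m_def)
  have "(\<lambda>x. density lborel (\<lambda>y. ennreal (f x y / m x))) \<in> measurable borel (prob_algebra borel)"
  proof (rule density_kernel_measurable)
    show "(\<integral>\<^sup>+y. ennreal (f x y / m x) \<partial>lborel) = 1" for x
    proof -
      have "(\<integral>\<^sup>+y. ennreal (f x y / m x) \<partial>lborel) = (\<integral>\<^sup>+y. ennreal (1 / m x) * ennreal (f x y) \<partial>lborel)"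
        using m_pos[of x] f_nonneg by (intro nn_integral_cong) (simp add: ennreal_mult [symmetric])
      also have "\<dots> = ennreal (1 / m x) * ennreal (m x)"
        by (subst nn_integral_cmult) (simp_all add: f_one)
      finally show ?thesis using m_pos[of x] by (simp add: ennreal_mult [symmetric])
    qed
  qed measurable
  moreover have "emeasure M {w \<in> space M. X w \<in> A \<and> Y w \<in> B} =
      (\<integral>\<^sup>+x\<in>A. emeasure (density lborel (\<lambda>y. ennreal (f x y / m x))) B \<partial>distr M borel X)"
    if [measurable]: "A \<in> sets borel" "B \<in> sets borel" for A B
  proof -
    have "(\<integral>\<^sup>+x\<in>A. emeasure (density lborel (\<lambda>y. ennreal (f x y / m x))) B \<partial>distr M borel X) =
        (\<integral>\<^sup>+x. ennreal (m x) * ((\<integral>\<^sup>+y\<in>B. ennreal (f x y / m x) \<partial>lborel) * indicator A x) \<partial>lborel)"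
      unfolding X_law by (simp add: emeasure_density nn_integral_density)
    also have "\<dots> = (\<integral>\<^sup>+x\<in>A. (\<integral>\<^sup>+y\<in>B. ennreal (f x y) \<partial>lborel) \<partial>lborel)"
      by (intro nn_integral_cong)
        (simp add: mult.assoc [symmetric] ratio nn_integral_cmult [symmetric])
    also have "\<dots> = (\<integral>\<^sup>+x\<in>A. (\<integral>\<^sup>+t. ennreal (p t x) * (\<integral>\<^sup>+y\<in>B. q t y \<partial>lborel) \<partial>prior) \<partial>lborel)"
    proof (intro nn_integral_cong arg_cong2[of _ _ _ _ "(*)"] refl)
      fix x
      have "(\<integral>\<^sup>+y\<in>B. ennreal (f x y) \<partial>lborel) =
          (\<integral>\<^sup>+y. (\<integral>\<^sup>+t. ennreal (p t x) * (ennreal (q t y) * indicator B y) \<partial>prior) \<partial>lborel)"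
        by (simp add: f_eq nn_integral_multc [symmetric] mult.assoc)
      also have "\<dots> = (\<integral>\<^sup>+t. (\<integral>\<^sup>+y. ennreal (p t x) * (ennreal (q t y) * indicator B y) \<partial>lborel) \<partial>prior)"
        by (rule PB.Fubini') measurable
      also have "\<dots> = (\<integral>\<^sup>+t. ennreal (p t x) * (\<integral>\<^sup>+y\<in>B. q t y \<partial>lborel) \<partial>prior)"
        by (intro nn_integral_cong nn_integral_cmult) (simp add: space_prior)
      finally show "(\<integral>\<^sup>+y\<in>B. ennreal (f x y) \<partial>lborel) =
        (\<integral>\<^sup>+t. ennreal (p t x) * (\<integral>\<^sup>+y\<in>B. q t y \<partial>lborel) \<partial>prior)" .
    qed
    also have "\<dots> = (\<integral>\<^sup>+x. (\<integral>\<^sup>+t. ennreal (p t x) * indicator A x * (\<integral>\<^sup>+y\<in>B. q t y \<partial>lborel) \<partial>prior) \<partial>lborel)"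
      by (intro nn_integral_cong, subst nn_integral_multc [symmetric])
        (auto intro!: nn_integral_cong simp: mult_ac space_prior)
    also have "\<dots> = (\<integral>\<^sup>+t. (\<integral>\<^sup>+x. ennreal (p t x) * indicator A x * (\<integral>\<^sup>+y\<in>B. q t y \<partial>lborel) \<partial>lborel) \<partial>prior)"
      by (rule PA.Fubini') measurable
    also have "\<dots> = (\<integral>\<^sup>+t. (\<integral>\<^sup>+x\<in>A. p t x \<partial>lborel) * (\<integral>\<^sup>+y\<in>B. q t y \<partial>lborel) \<partial>prior)"
      by (intro nn_integral_cong nn_integral_multc) (simp add: space_prior)
    finally show ?thesis by (simp add: joint)
  qed
  ultimately show ?thesis
    unfolding has_cond_distr_def pred_eq by simp
qed

section \<open>Mean mixtures with scalar covariance matrix\<close>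

lemma mvn_density_scalar_cov:
  fixes m x :: "real^'n"
  assumes "s > 0"
  shows "mvn_density m (mat s) x = isotropic_normal s (x - m)"
proof -
  have app: "(mat a :: real^'n^'n) *v z = a *\<^sub>R z" for a z
  proof -
    have "(mat a :: real^'n^'n) = a *\<^sub>R mat 1"
      by (simp add: mat_def vec_eq_iff)
    then show ?thesis
      by (metis matrix_vector_mul_lid scaleR_matrix_vector_assoc)
  qed
  have mult: "(mat a :: real^'n^'n) ** mat b = mat (a * b)" for a b
    by (simp add: matrix_eq matrix_vector_mul_assoc [symmetric] app)
  have "\<exists>A'. (mat s :: real^'n^'n) ** A' = mat 1 \<and> A' ** mat s = mat 1"
    using assms by (intro exI[of _ "mat (1 / s)"]) (simp add: mult)
  then have inv: "(mat s :: real^'n^'n) ** matrix_inv (mat s) = mat 1"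
    unfolding matrix_inv_def by (rule someI2_ex) simp
  have "matrix_inv (mat s :: real^'n^'n) = (mat (1 / s) ** mat s) ** matrix_inv (mat s)"
    using assms by (simp add: mult)
  also have "\<dots> = mat (1 / s)"
    by (simp add: matrix_mul_assoc [symmetric] inv)
  finally have inv: "matrix_inv (mat s :: real^'n^'n) = mat (1 / s)" .
  have det: "det (mat s :: real^'n^'n) = s ^ CARD('n)"
    by (subst det_diagonal) (simp_all add: mat_def)
  show ?thesis
    by (simp add: mvn_density_def isotropic_normal_def inv app det power2_norm_eq_inner power_mult_distrib)
qed

lemma mvn_scalar_cov_eq_density:
  "s > 0 \<Longrightarrow> mvn m (mat s) = density lborel (\<lambda>x. isotropic_normal s (x - m))"
  by (simp add: mvn_def mvn_density_scalar_cov)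

lemma prob_space_mvn_scalar_cov: "s > 0 \<Longrightarrow> prob_space (mvn m (mat s))"
  by (intro prob_spaceI)
    (simp add: mvn_scalar_cov_eq_density emeasure_density nn_integral_isotropic_normal)

lemma bind_mvn_scalar_cov:
  fixes h :: "'v \<Rightarrow> real^'n"
  assumes "prob_space L" "h \<in> borel_measurable L" "s > 0"
  shows "L \<bind> (\<lambda>v. mvn (h v) (mat s)) = density lborel (\<lambda>x. \<integral>\<^sup>+v. isotropic_normal s (x - h v) \<partial>L)"
  using assms unfolding mvn_scalar_cov_eq_density[OF assms(3)]
  by (intro bind_density_lborel) (auto simp: nn_integral_isotropic_normal)

lemma mmn_density_nonneg: "s > 0 \<Longrightarrow> mmn_density t a (mat s) L x \<ge> 0"
  by (simp add: mmn_density_def mvn_density_scalar_cov isotropic_normal_nonneg)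

context
  fixes L :: "real measure" and a :: "real^'n" and s :: real
  assumes L: "real_distribution L" and s: "s > 0"
begin

interpretation L: real_distribution L by (rule L)

lemma mmn_density_scalar_cov:
  "mmn_density t a (mat s) L x = (\<integral>v. isotropic_normal s (x - (t + v *\<^sub>R a)) \<partial>L)"
  by (simp add: mmn_density_def mvn_density_scalar_cov s)

lemma ennreal_mmn_density:
  "ennreal (mmn_density t a (mat s) L x) = (\<integral>\<^sup>+v. isotropic_normal s (x - (t + v *\<^sub>R a)) \<partial>L)"
  unfolding mmn_density_scalar_cov
  by (intro nn_integral_eq_integral [symmetric] integrable_isotropic_normal_mixture)
    (auto simp: s isotropic_normal_nonneg L.prob_space_axioms)

lemma mmn_density_pos: "mmn_density t a (mat s) L x > 0"
  unfolding mmn_density_scalar_cov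
  by (intro L.expectation_greater integrable_isotropic_normal_mixture)
    (auto simp: s isotropic_normal_pos L.prob_space_axioms)

lemma mmn_density_le_mode: "mmn_density t a (mat s) L x \<le> isotropic_normal s (0::real^'n)"
  unfolding mmn_density_scalar_cov
  by (intro L.integral_le_const integrable_isotropic_normal_mixture)
    (auto simp: s isotropic_normal_le_mode L.prob_space_axioms)

lemma mmn_density_measurable [measurable]:
  "(\<lambda>(t, x). mmn_density t a (mat s) L x) \<in> borel_measurable (borel \<Otimes>\<^sub>M borel)"
  unfolding mmn_density_scalar_cov by measurable

lemma mmn_eq_density: "mmn t a (mat s) L = density lborel (mmn_density t a (mat s) L)"
  unfolding mmn_def ennreal_mmn_density
  by (rule bind_mvn_scalar_cov) (auto simp: s L.prob_space_axioms)

lemma nn_integral_mmn_density: "(\<integral>\<^sup>+x. mmn_density t a (mat s) L x \<partial>lborel) = 1"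
proof -
  interpret pair_sigma_finite L "lborel :: (real^'n) measure" ..
  have "(\<integral>\<^sup>+x. mmn_density t a (mat s) L x \<partial>lborel) =
      (\<integral>\<^sup>+v. \<integral>\<^sup>+x. isotropic_normal s (x - (t + v *\<^sub>R a)) \<partial>lborel \<partial>L)"
    unfolding ennreal_mmn_density by (rule Fubini') measurable
  also have "\<dots> = 1"
    using L.emeasure_space_1 by (simp add: nn_integral_isotropic_normal s)
  finally show ?thesis .
qed

end

lemma mmn2_scalar_cov_eq_density:
  fixes m a b :: "real^'n"
  assumes K: "real_distribution K" and L: "real_distribution L" and s: "s > 0"
  shows "mmn2 m a b (mat s) (K \<Otimes>\<^sub>M L) =
    density lborel (\<lambda>x. \<integral>\<^sup>+k. \<integral>\<^sup>+j. isotropic_normal s (x - (m + k *\<^sub>R a + j *\<^sub>R b)) \<partial>L \<partial>K)"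
proof -
  interpret K: real_distribution K by fact
  interpret L: real_distribution L by fact
  interpret pair_prob_space K L ..
  have "mmn2 m a b (mat s) (K \<Otimes>\<^sub>M L) =
      (K \<Otimes>\<^sub>M L) \<bind> (\<lambda>w. mvn (m + fst w *\<^sub>R a + snd w *\<^sub>R b) (mat s))"
    unfolding mmn2_def case_prod_beta' ..
  also have "\<dots> = density lborel
      (\<lambda>x. \<integral>\<^sup>+w. isotropic_normal s (x - (m + fst w *\<^sub>R a + snd w *\<^sub>R b)) \<partial>(K \<Otimes>\<^sub>M L))"
    by (rule bind_mvn_scalar_cov) (auto simp: s prob_space_axioms)
  also have "\<dots> = density lborel (\<lambda>x. \<integral>\<^sup>+k. \<integral>\<^sup>+j. isotropic_normal s (x - (m + k *\<^sub>R a + j *\<^sub>R b)) \<partial>L \<partial>K)"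
    by (subst L.nn_integral_fst [symmetric]) auto
  finally show ?thesis .
qed

text \<open>
  If both directions are multiples of \<open>a\<close>, the mean is \<open>m + (\<alpha> k + \<beta> j) a\<close>, a function of the
  combined mixing variable alone.
\<close>

lemma mmn2_collinear_eq_mmn:
  fixes m a :: "real^'n"
  assumes K: "real_distribution K" and L: "real_distribution L" and s: "s > 0"
  shows "mmn2 m (\<alpha> *\<^sub>R a) (\<beta> *\<^sub>R a) (mat s) (K \<Otimes>\<^sub>M L) =
    mmn m a (mat s) (distr (K \<Otimes>\<^sub>M L) borel (\<lambda>(k, j). \<alpha> * k + \<beta> * j))"
proof -
  interpret K: real_distribution K by fact
  interpret L: real_distribution L by fact
  interpret pair_prob_space K L ..
  have "(\<lambda>v. mvn (m + v *\<^sub>R a) (mat s)) \<in> measurable borel (subprob_algebra borel)"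
    unfolding mvn_scalar_cov_eq_density[OF s]
    by (intro measurable_prob_algebraD density_kernel_measurable) (auto simp: nn_integral_isotropic_normal s)
  then have "mmn m a (mat s) (distr (K \<Otimes>\<^sub>M L) borel (\<lambda>(k, j). \<alpha> * k + \<beta> * j)) =
      (K \<Otimes>\<^sub>M L) \<bind> (\<lambda>w. mvn (m + (case w of (k, j) \<Rightarrow> \<alpha> * k + \<beta> * j) *\<^sub>R a) (mat s))"
    unfolding mmn_def by (intro bind_distr) (auto simp: not_empty)
  also have "\<dots> = mmn2 m (\<alpha> *\<^sub>R a) (\<beta> *\<^sub>R a) (mat s) (K \<Otimes>\<^sub>M L)"
    unfolding mmn2_def
    by (intro bind_cong refl) (auto simp: case_prod_beta algebra_simps)
  finally show ?thesis ..
qed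

lemma mmn2_zero_eq_mmn:
  fixes m b :: "real^'n"
  assumes K: "real_distribution K" and L: "real_distribution L" and s: "s > 0"
  shows "mmn2 m 0 b (mat s) (K \<Otimes>\<^sub>M L) = mmn m b (mat s) L"
proof -
  interpret K: real_distribution K by fact
  show ?thesis
    using K.emeasure_space_1
    by (simp add: mmn2_scalar_cov_eq_density[OF assms] mmn_eq_density[OF L s] ennreal_mmn_density[OF L s])
qed

lemma mmn_zero_eq_mvn:
  assumes "real_distribution L" and "s > 0"
  shows "mmn m 0 (mat s) L = mvn m (mat s)"
  using bind_const'[OF real_distribution.axioms(1)[OF assms(1)]
      prob_space_imp_subprob_space[OF prob_space_mvn_scalar_cov[OF assms(2)]]]
  by (simp add: mmn_def)

section \<open>Tilting the law of the mixing variable\<close>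

text \<open>
  These values of the parameters make the tilt a ratio of two normal densities, hence bounded, also
  when \<open>a = 0\<close>; for other parameters it need not be integrable.
\<close>

lemma integrable_exp_tilt:
  fixes z a :: "'a::euclidean_space"
  assumes "real_distribution L" "s > 0"
  shows "integrable L (exp_tilt ((norm a)\<^sup>2 / s) ((z \<bullet> a) / s))"
proof -
  interpret real_distribution L by fact
  have "exp_tilt ((norm a)\<^sup>2 / s) ((z \<bullet> a) / s) =
      (\<lambda>v. isotropic_normal s (z - v *\<^sub>R a) / isotropic_normal s z)"
    using isotropic_normal_pos[OF assms(2), of z]
    by (simp add: fun_eq_iff isotropic_normal_shift_eq_exp_tilt[OF assms(2)])
  then show ?thesis
    using integrable_isotropic_normal_mixture[OF prob_space_axioms, of "\<lambda>v. z - v *\<^sub>R a" s] assms(2)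
    by simp
qed

lemma integral_exp_tilt_pos:
  assumes "real_distribution L" "integrable L (exp_tilt A B)"
  shows "(\<integral>v. exp_tilt A B v \<partial>L) > 0"
proof -
  interpret real_distribution L by fact
  show ?thesis
    using assms(2) by (intro expectation_greater) (simp_all add: exp_tilt_pos)
qed

text \<open>
  Tilting the density \<open>g\<close> with respect to \<open>\<nu>\<close> is tilting the measure \<open>density \<nu> g\<close>. If the latter is
  a probability measure, Tonelli's theorem applies to it even when \<open>\<nu>\<close> is not \<open>\<sigma>\<close>-finite.
\<close>

lemma density_normalized_density:
  assumes [measurable]: "g \<in> borel_measurable \<nu>" "h \<in> borel_measurable \<nu>"
    and g: "\<And>k. g k \<ge> 0" and h: "\<And>k. h k \<ge> 0"
  shows "density \<nu> (normalized_density \<nu> (\<lambda>k. g k * h k)) =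
    density (density \<nu> g) (normalized_density (density \<nu> g) h)"
proof -
  have "(\<integral>k. h k \<partial>density \<nu> g) = (\<integral>k. g k * h k \<partial>\<nu>)"
    by (subst integral_density) (auto simp: g)
  moreover have "(\<integral>k. g k * h k \<partial>\<nu>) \<ge> 0"
    by (simp add: g h)
  ultimately show ?thesis
    unfolding normalized_density_def
    by (subst density_density_eq) (auto simp: ennreal_mult [symmetric] g h)
qed

lemma real_distribution_normalized_density:
  assumes L: "real_distribution L" and h: "integrable L h" "\<And>k. h k \<ge> 0" "(\<integral>k. h k \<partial>L) > 0"
  shows "real_distribution (density L (normalized_density L h))"
proof -
  interpret real_distribution L by fact
  have [measurable]: "h \<in> borel_measurable L" using h(1) by auto
  have "(\<integral>\<^sup>+k. normalized_density L h k \<partial>L) = ennreal ((\<integral>k. h k \<partial>L) / (\<integral>k. h k \<partial>L))"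
    unfolding normalized_density_def using h
    by (subst nn_integral_eq_integral) auto
  also have "\<dots> = 1" using h(3) by simp
  finally have "prob_space (density L (normalized_density L h))"
    by (intro prob_spaceI) (simp add: emeasure_density normalized_density_def cong: nn_integral_cong)
  then show ?thesis
    by (simp add: real_distribution_def real_distribution_axioms_def)
qed

section \<open>Prior averages of mixture densities\<close>

text \<open>
  The densities are bounded by the value of the normal density at its mode, uniformly in the
  parameter, so they are integrable against the prior.
\<close>

context
  fixes L :: "real measure" and a m :: "real^'n" and s t :: real
  assumes L: "real_distribution L" and s: "s > 0" and t: "t > 0"
begin

interpretation prior: prob_space "mvn m (mat t)" by (rule prob_space_mvn_scalar_cov[OF t])

lemma mmn_density_measurable_prior:
  "(\<lambda>u. mmn_density u a (mat s) L x) \<in> borel_measurable (mvn m (mat t))"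
  using mmn_density_measurable[OF L s, measurable] by (simp add: mvn_def)

lemma integrable_prior_mmn_density: "integrable (mvn m (mat t)) (\<lambda>u. mmn_density u a (mat s) L x)"
  by (rule prior.integrable_const_bound[where B = "isotropic_normal s (0::real^'n)"])
    (simp_all add: mmn_density_nonneg mmn_density_le_mode mmn_density_measurable_prior L s)

lemma integral_prior_mmn_density_pos: "(\<integral>u. mmn_density u a (mat s) L x \<partial>mvn m (mat t)) > 0"
  by (intro prior.expectation_greater integrable_prior_mmn_density) (simp add: mmn_density_pos L s)

lemma integrable_prior_mmn_density_mult:
  assumes N: "real_distribution N" and r: "r > 0"
  shows "integrable (mvn m (mat t)) (\<lambda>u. mmn_density u a (mat s) L x * mmn_density u b (mat r) N y)"
proof (rule Bochner_Integration.integrable_bound)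
  show "integrable (mvn m (mat t)) (\<lambda>u. mmn_density u a (mat s) L x * isotropic_normal r (0::real^'n))"
    using integrable_prior_mmn_density by simp
  have "(\<lambda>u. mmn_density u b (mat r) N y) \<in> borel_measurable (mvn m (mat t))"
    using mmn_density_measurable[OF N r, measurable] by (simp add: mvn_def)
  with mmn_density_measurable_prior
  show "(\<lambda>u. mmn_density u a (mat s) L x * mmn_density u b (mat r) N y) \<in> borel_measurable (mvn m (mat t))"
    by (rule borel_measurable_times)
qed (simp add: mmn_density_nonneg mmn_density_le_mode L s N r mult_left_mono abs_mult
    isotropic_normal_nonneg)

end

text \<open>
  The marginal density of \<open>X\<close>. For a fixed value \<open>v\<close> of the mixing variable it is a convolution of two
  normal densities at \<open>x - v a - m\<close>, and shifting back to \<open>x - m\<close> produces the tilt.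
\<close>

lemma mmn_density_marginal:
  fixes a m x :: "real^'n"
  assumes L: "real_distribution L" and s: "s > 0" and t: "t > 0"
  shows "(\<integral>\<^sup>+u. mmn_density u a (mat s) L x \<partial>mvn m (mat t)) =
    isotropic_normal (s + t) (x - m) *
    (\<integral>v. exp_tilt ((norm a)\<^sup>2 / (s + t)) (((x - m) \<bullet> a) / (s + t)) v \<partial>L)"
proof -
  interpret L: real_distribution L by fact
  interpret pair_sigma_finite L "lborel :: (real^'n) measure" ..
  have st: "s + t > 0" using s t by simp
  have commute: "x - v *\<^sub>R a - m = x - m - v *\<^sub>R a" for v by simp
  have "(\<integral>\<^sup>+u. mmn_density u a (mat s) L x \<partial>mvn m (mat t)) =
      (\<integral>\<^sup>+u. \<integral>\<^sup>+v. isotropic_normal s (x - v *\<^sub>R a - u) * isotropic_normal t (u - m) \<partial>L \<partial>lborel)"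
    by (simp add: mvn_scalar_cov_eq_density nn_integral_density ennreal_mmn_density assms
        nn_integral_cmult ennreal_mult isotropic_normal_nonneg diff_diff_eq add.commute
        mult.commute)
  also have "\<dots> = (\<integral>\<^sup>+v. \<integral>\<^sup>+u. isotropic_normal s (x - v *\<^sub>R a - u) * isotropic_normal t (u - m) \<partial>lborel \<partial>L)"
    by (rule Fubini') measurable
  also have "\<dots> = (\<integral>\<^sup>+v. isotropic_normal (s + t) (x - m) *
      exp_tilt ((norm a)\<^sup>2 / (s + t)) (((x - m) \<bullet> a) / (s + t)) v \<partial>L)"
    by (simp add: nn_integral_isotropic_normal_convolution s t commute
        isotropic_normal_shift_eq_exp_tilt[OF st])
  also have "\<dots> = isotropic_normal (s + t) (x - m) *
      (\<integral>v. exp_tilt ((norm a)\<^sup>2 / (s + t)) (((x - m) \<bullet> a) / (s + t)) v \<partial>L)"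
    using integrable_exp_tilt[OF L st, of a "x - m"]
    by (subst nn_integral_eq_integral) (simp_all add: isotropic_normal_nonneg ennreal_mult st exp_tilt_nonneg)
  finally show ?thesis .
qed

text \<open>
  The joint density of \<open>(X, Y)\<close>. For fixed values \<open>v\<close>, \<open>w\<close> of the mixing variables the integral over
  the parameter is the conjugate one, with observations \<open>x - v a\<close> and \<open>y - w b\<close>.
\<close>

lemma mmn_density_joint_marginal:
  fixes a b m x y :: "real^'n"
  assumes L: "real_distribution L" and N: "real_distribution N"
    and s: "s > 0" and t: "t > 0" and r: "r > 0"
  defines "\<omega> \<equiv> t / (t + s)"
  shows "(\<integral>\<^sup>+u. ennreal (mmn_density u a (mat s) L x * mmn_density u b (mat r) N y) \<partial>mvn m (mat t)) =
    isotropic_normal (s + t) (x - m) *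
    (\<integral>\<^sup>+v. exp_tilt ((norm a)\<^sup>2 / (s + t)) (((x - m) \<bullet> a) / (s + t)) v *
       (\<integral>\<^sup>+w. isotropic_normal (\<omega> * s + r)
          (y - (\<omega> *\<^sub>R x + (1 - \<omega>) *\<^sub>R m + v *\<^sub>R (- \<omega> *\<^sub>R a) + w *\<^sub>R b)) \<partial>N) \<partial>L)"
proof -
  interpret L: real_distribution L by fact
  interpret N: real_distribution N by fact
  interpret PL: pair_sigma_finite L "lborel :: (real^'n) measure" ..
  interpret PN: pair_sigma_finite N "lborel :: (real^'n) measure" ..
  have st: "s + t > 0" using s t by simp
  have commute: "x - v *\<^sub>R a - m = x - m - v *\<^sub>R a" for v by simp
  have "\<omega> * s > 0" using s t by (simp add: \<omega>_def)
  then have \<omega>r: "\<omega> * s + r > 0" using r by simp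
  let ?e = "exp_tilt ((norm a)\<^sup>2 / (s + t)) (((x - m) \<bullet> a) / (s + t))"
  let ?F = "\<lambda>v w u. ennreal (isotropic_normal s (x - v *\<^sub>R a - u) * isotropic_normal r (y - w *\<^sub>R b - u) *
      isotropic_normal t (u - m))"
  have "(\<integral>\<^sup>+u. ennreal (mmn_density u a (mat s) L x * mmn_density u b (mat r) N y) \<partial>mvn m (mat t)) =
      (\<integral>\<^sup>+u. isotropic_normal t (u - m) * ((\<integral>\<^sup>+v. isotropic_normal s (x - v *\<^sub>R a - u) \<partial>L) *
        (\<integral>\<^sup>+w. isotropic_normal r (y - w *\<^sub>R b - u) \<partial>N)) \<partial>lborel)"
    by (simp add: mvn_scalar_cov_eq_density nn_integral_density ennreal_mmn_density assms ennreal_mult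
        mmn_density_nonneg diff_diff_eq add.commute)
  also have "\<dots> = (\<integral>\<^sup>+u. \<integral>\<^sup>+v. \<integral>\<^sup>+w. ?F v w u \<partial>N \<partial>L \<partial>lborel)"
    by (simp add: nn_integral_multc nn_integral_cmult ennreal_mult isotropic_normal_nonneg s t r
        mult.commute mult.left_commute)
  also have "\<dots> = (\<integral>\<^sup>+v. \<integral>\<^sup>+u. \<integral>\<^sup>+w. ?F v w u \<partial>N \<partial>lborel \<partial>L)"
    by (rule PL.Fubini') measurable
  also have "\<dots> = (\<integral>\<^sup>+v. \<integral>\<^sup>+w. \<integral>\<^sup>+u. ?F v w u \<partial>lborel \<partial>N \<partial>L)"
    by (intro nn_integral_cong PN.Fubini') measurable
  also have "\<dots> = (\<integral>\<^sup>+v. \<integral>\<^sup>+w. isotropic_normal (s + t) (x - m) * (?e v *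
      isotropic_normal (\<omega> * s + r)
          (y - (\<omega> *\<^sub>R x + (1 - \<omega>) *\<^sub>R m + v *\<^sub>R (- \<omega> *\<^sub>R a) + w *\<^sub>R b))) \<partial>N \<partial>L)"
  proof (intro nn_integral_cong)
    fix v w :: real
    have mean: "y - w *\<^sub>R b - (\<omega> *\<^sub>R (x - v *\<^sub>R a) + (1 - \<omega>) *\<^sub>R m) =
        y - (\<omega> *\<^sub>R x + (1 - \<omega>) *\<^sub>R m + v *\<^sub>R (- \<omega> *\<^sub>R a) + w *\<^sub>R b)"
      by (simp add: algebra_simps)
    show "(\<integral>\<^sup>+u. ?F v w u \<partial>lborel) = ennreal (isotropic_normal (s + t) (x - m) * (?e v *
      isotropic_normal (\<omega> * s + r)
          (y - (\<omega> *\<^sub>R x + (1 - \<omega>) *\<^sub>R m + v *\<^sub>R (- \<omega> *\<^sub>R a) + w *\<^sub>R b))))"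
      unfolding nn_integral_normal_conjugacy[OF s t r, folded \<omega>_def] commute
        isotropic_normal_shift_eq_exp_tilt[OF st] mean
      by (simp only: mult.assoc)
  qed
  also have "\<dots> = isotropic_normal (s + t) (x - m) *
    (\<integral>\<^sup>+v. ?e v * (\<integral>\<^sup>+w. isotropic_normal (\<omega> * s + r)
          (y - (\<omega> *\<^sub>R x + (1 - \<omega>) *\<^sub>R m + v *\<^sub>R (- \<omega> *\<^sub>R a) + w *\<^sub>R b)) \<partial>N) \<partial>L)"
    by (simp add: nn_integral_cmult ennreal_mult exp_tilt_nonneg isotropic_normal_nonneg[OF st]
        isotropic_normal_nonneg[OF \<omega>r])
  finally show ?thesis .
qed

section \<open>The predictive distribution\<close>

text \<open>
  In the quotient of the two marginals the factor \<open>isotropic_normal (s + t) (x - m)\<close> cancels, and the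
  integral \<open>Z\<close> of the tilt that is left in the denominator normalizes the law of the mixing variable.
\<close>

lemma mmn_bayes_predictive_density:
  fixes a b m x y :: "real^'n"
  assumes L: "real_distribution L" and N: "real_distribution N"
    and s: "s > 0" and r: "r > 0" and t: "t > 0"
  defines "\<omega> \<equiv> t / (t + s)"
    and "h \<equiv> exp_tilt ((norm a)\<^sup>2 / (s + t)) (((x - m) \<bullet> a) / (s + t))"
  shows "ennreal (bayes_predictive_density (mvn m (mat t))
      (\<lambda>u. mmn_density u a (mat s) L) (\<lambda>u. mmn_density u b (mat r) N) x y) =
    (\<integral>\<^sup>+v. \<integral>\<^sup>+w. isotropic_normal (\<omega> * s + r)
        (y - (\<omega> *\<^sub>R x + (1 - \<omega>) *\<^sub>R m + v *\<^sub>R (- \<omega> *\<^sub>R a) + w *\<^sub>R b)) \<partial>N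
      \<partial>density L (normalized_density L h))"
proof -
  interpret L: real_distribution L by fact
  interpret N: real_distribution N by fact
  have st: "s + t > 0" using s t by simp
  define f where "f = (\<integral>u. mmn_density u a (mat s) L x * mmn_density u b (mat r) N y \<partial>mvn m (mat t))"
  define d where "d = (\<integral>u. mmn_density u a (mat s) L x \<partial>mvn m (mat t))"
  define c where "c = isotropic_normal (s + t) (x - m)"
  define Z where "Z = (\<integral>v. h v \<partial>L)"
  define G where "G v = (\<integral>\<^sup>+w. isotropic_normal (\<omega> * s + r)
        (y - (\<omega> *\<^sub>R x + (1 - \<omega>) *\<^sub>R m + v *\<^sub>R (- \<omega> *\<^sub>R a) + w *\<^sub>R b)) \<partial>N)" for v
  have [measurable]: "G \<in> borel_measurable borel" "h \<in> borel_measurable borel"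
    unfolding G_def h_def by measurable
  have normalized: "normalized_density L h v = h v / Z" and h_nonneg: "h v \<ge> 0" for v
    by (simp_all add: normalized_density_def Z_def h_def exp_tilt_nonneg)
  have c: "c > 0" unfolding c_def by (rule isotropic_normal_pos[OF st])
  have Z: "Z > 0"
    unfolding Z_def h_def by (intro integral_exp_tilt_pos integrable_exp_tilt L st)
  have f_eq: "ennreal f = c * (\<integral>\<^sup>+v. h v * G v \<partial>L)"
    unfolding f_def c_def h_def G_def \<omega>_def mmn_density_joint_marginal[OF L N s t r, symmetric]
    by (intro nn_integral_eq_integral [symmetric] integrable_prior_mmn_density_mult L N s t r)
      (simp add: mmn_density_nonneg s r)
  have "ennreal d = ennreal (c * Z)"
    unfolding d_def c_def h_def Z_def mmn_density_marginal[OF L s t, symmetric]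
    by (intro nn_integral_eq_integral [symmetric] integrable_prior_mmn_density L s t)
      (simp add: mmn_density_nonneg s)
  then have d_eq: "d = c * Z"
    using c Z integral_prior_mmn_density_pos[OF L s t, of m a x]
    by (subst (asm) ennreal_inj) (simp_all add: d_def less_imp_le)
  have f_nonneg: "f \<ge> 0"
    unfolding f_def
    by (intro Bochner_Integration.integral_nonneg) (simp add: mmn_density_nonneg s r)
  have "ennreal (f / d) = ennreal (1 / Z) * (ennreal (1 / c) * ennreal f)"
    using c Z f_nonneg by (simp add: d_eq ennreal_mult [symmetric] mult.commute)
  also have "\<dots> = ennreal (1 / Z) * (\<integral>\<^sup>+v. h v * G v \<partial>L)"
    unfolding f_eq mult.assoc [symmetric] using c by (simp add: mult.assoc ennreal_mult [symmetric])
  also have "\<dots> = (\<integral>\<^sup>+v. ennreal (normalized_density L h v) * G v \<partial>L)"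
    using Z by (subst nn_integral_cmult [symmetric])
      (auto intro!: nn_integral_cong
        simp: normalized mult.assoc [symmetric] ennreal_mult [symmetric] h_nonneg)
  also have "\<dots> = (\<integral>\<^sup>+v. G v \<partial>density L (normalized_density L h))"
    by (subst nn_integral_density) (auto simp: normalized_density_def)
  finally show ?thesis
    unfolding bayes_predictive_density_def f_def d_def G_def .
qed

theorem theorem3:
  fixes M :: "'w measure"
    and T X Y :: "'w \<Rightarrow> real^'d"
    and \<mu> aX aY :: "real^'d"
    and \<sigma>X \<sigma>Y \<tau> \<omega> A :: real
    and B :: "real^'d \<Rightarrow> real"
    and L1 L2 \<nu> :: "real measure"
    and g :: "real \<Rightarrow> real"
    and g\<pi> :: "real^'d \<Rightarrow> real \<Rightarrow> real"
    and K :: "real^'d \<Rightarrow> real measure"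
    and pred :: "real^'d \<Rightarrow> (real^'d) measure"
  assumes "prob_space M"
    and "\<sigma>X\<^sup>2 > 0" and "\<sigma>Y\<^sup>2 > 0" and "\<tau>\<^sup>2 > 0"
    and "real_distribution L1" and "real_distribution L2"
    and "sets \<nu> = sets borel"
    and "g \<in> borel_measurable borel" and "\<And>k. g k \<ge> 0"
    and L1_density: "L1 = density \<nu> (\<lambda>k. ennreal (g k))"
    and prior: "T \<in> borel_measurable M" "distr M borel T = mvn \<mu> (mat (\<tau>\<^sup>2))"
    and model: "has_cond_distr M T borel (\<lambda>w. (X w, Y w)) (borel \<Otimes>\<^sub>M borel)
           (\<lambda>t. mmn t aX (mat (\<sigma>X\<^sup>2)) L1 \<Otimes>\<^sub>M mmn t aY (mat (\<sigma>Y\<^sup>2)) L2)"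
    and pred_def: "\<And>x. pred x = density lborel (\<lambda>y. ennreal
           (bayes_predictive_density (mvn \<mu> (mat (\<tau>\<^sup>2)))
              (\<lambda>t. mmn_density t aX (mat (\<sigma>X\<^sup>2)) L1)
              (\<lambda>t. mmn_density t aY (mat (\<sigma>Y\<^sup>2)) L2) x y))"
    and \<omega>_def: "\<omega> = \<tau>\<^sup>2 / (\<tau>\<^sup>2 + \<sigma>X\<^sup>2)"
    and A_def: "A = (norm aX)\<^sup>2 / (\<sigma>X\<^sup>2 + \<tau>\<^sup>2)"
    and B_def: "\<And>x. B x = ((x - \<mu>) \<bullet> aX) / (\<sigma>X\<^sup>2 + \<tau>\<^sup>2)"
    and g\<pi>_def: "\<And>x. g\<pi> x = normalized_density \<nu> (\<lambda>k. g k * exp (- A / 2 * k\<^sup>2 + B x * k))"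
    and K_def: "\<And>x. K x = density \<nu> (\<lambda>k. ennreal (g\<pi> x k))"
  shows
    "has_cond_distr M X borel Y borel pred \<and>
     (\<forall>x. real_distribution (K x) \<and>
        pred x = mmn2 (\<omega> *\<^sub>R x + (1 - \<omega>) *\<^sub>R \<mu>) (- \<omega> *\<^sub>R aX) aY
                   (mat (\<omega> * \<sigma>X\<^sup>2 + \<sigma>Y\<^sup>2)) (K x \<Otimes>\<^sub>M L2)) \<and>
     (\<forall>c x. aX \<noteq> 0 \<and> aY = c *\<^sub>R aX \<longrightarrow>
        pred x = mmn (\<omega> *\<^sub>R x + (1 - \<omega>) *\<^sub>R \<mu>) aX (mat (\<omega> * \<sigma>X\<^sup>2 + \<sigma>Y\<^sup>2))
                   (distr (K x \<Otimes>\<^sub>M L2) borel (\<lambda>(k, j). c * j - \<omega> * k))) \<and>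
     (aX = 0 \<longrightarrow>
        (\<forall>t. mmn t aX (mat (\<sigma>X\<^sup>2)) L1 = mvn t (mat (\<sigma>X\<^sup>2))) \<and>
        (\<forall>x. pred x = mmn (\<omega> *\<^sub>R x + (1 - \<omega>) *\<^sub>R \<mu>) aY (mat (\<omega> * \<sigma>X\<^sup>2 + \<sigma>Y\<^sup>2)) L2))"
proof -
  define s r t where "s = \<sigma>X\<^sup>2" and "r = \<sigma>Y\<^sup>2" and "t = \<tau>\<^sup>2"
  have s: "s > 0" and r: "r > 0" and t: "t > 0"
    using assms(2-4) by (simp_all add: s_def r_def t_def)
  note L1 = \<open>real_distribution L1\<close> and L2 = \<open>real_distribution L2\<close>
  have \<omega>: "\<omega> = t / (t + s)" by (simp add: \<omega>_def s_def t_def)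
  have "\<omega> > 0" using s t by (simp add: \<omega>)
  then have cov: "\<omega> * s + r > 0" using s r by (simp add: add_pos_pos)
  let ?h = "\<lambda>x. exp_tilt ((norm aX)\<^sup>2 / (s + t)) (((x - \<mu>) \<bullet> aX) / (s + t))"
  \<comment> \<open>The tilt in the theorem is the one that a shift along \<open>aX\<close> produces at variance \<open>s + t\<close>.\<close>
  have h: "exp (- A / 2 * k\<^sup>2 + B x * k) = ?h x k" for x k
    by (simp add: exp_tilt_def A_def B_def s_def t_def)
  have K_eq: "K x = density L1 (normalized_density L1 (?h x))" for x
  proof -
    have meas: "g \<in> borel_measurable \<nu>" "?h x \<in> borel_measurable \<nu>"
      unfolding measurable_cong_sets[OF \<open>sets \<nu> = sets borel\<close> refl]
      using \<open>g \<in> borel_measurable borel\<close> by auto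
    show ?thesis
      unfolding K_def g\<pi>_def L1_density h
      by (intro density_normalized_density meas exp_tilt_nonneg \<open>\<And>k. g k \<ge> 0\<close>)
  qed
  have K: "real_distribution (K x)" for x
    unfolding K_eq using L1 s t
    by (intro real_distribution_normalized_density integral_exp_tilt_pos integrable_exp_tilt)
      (auto simp: exp_tilt_nonneg add_pos_pos)
  have pred_eq: "pred x = mmn2 (\<omega> *\<^sub>R x + (1 - \<omega>) *\<^sub>R \<mu>) (- \<omega> *\<^sub>R aX) aY
      (mat (\<omega> * s + r)) (K x \<Otimes>\<^sub>M L2)" for x
    unfolding pred_def s_def [symmetric] r_def [symmetric] t_def [symmetric]
      mmn_bayes_predictive_density[OF L1 L2 s r t] mmn2_scalar_cov_eq_density[OF K L2 cov]
    by (simp only: \<omega> K_eq)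
  have "has_cond_distr M X borel Y borel pred"
  proof -
    have pred_fun: "pred = (\<lambda>x. density lborel (\<lambda>y. ennreal (bayes_predictive_density (mvn \<mu> (mat t))
        (\<lambda>u. mmn_density u aX (mat s) L1) (\<lambda>u. mmn_density u aY (mat r) L2) x y)))"
      by (rule ext) (simp add: pred_def s_def r_def t_def)
    show ?thesis
      unfolding pred_fun
    proof (rule bayes_predictive_has_cond_distr[where T = T and N = borel])
      show "has_cond_distr M T borel (\<lambda>w. (X w, Y w)) (borel \<Otimes>\<^sub>M borel)
          (\<lambda>u. density lborel (mmn_density u aX (mat s) L1) \<Otimes>\<^sub>M density lborel (mmn_density u aY (mat r) L2))"
        using model
        unfolding s_def [symmetric] r_def [symmetric] mmn_eq_density[OF L1 s] mmn_eq_density[OF L2 r] .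
    qed (use \<open>prob_space M\<close> prior in \<open>auto simp: t_def [symmetric] mmn_density_nonneg s r t
        nn_integral_mmn_density[OF L1 s] nn_integral_mmn_density[OF L2 r]
        mmn_density_measurable[OF L1 s] mmn_density_measurable[OF L2 r]
        integrable_prior_mmn_density[OF L1 s t]
        integrable_prior_mmn_density_mult[OF L1 s t L2 r]
        integral_prior_mmn_density_pos[OF L1 s t]\<close>)
  qed
  moreover have "pred x = mmn (\<omega> *\<^sub>R x + (1 - \<omega>) *\<^sub>R \<mu>) aX (mat (\<omega> * s + r))
      (distr (K x \<Otimes>\<^sub>M L2) borel (\<lambda>(k, j). c * j - \<omega> * k))" if "aY = c *\<^sub>R aX" for c x
    unfolding pred_eq that mmn2_collinear_eq_mmn[OF K L2 cov]
    by (simp add: add.commute)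
  moreover have "pred x = mmn (\<omega> *\<^sub>R x + (1 - \<omega>) *\<^sub>R \<mu>) aY (mat (\<omega> * s + r)) L2" if "aX = 0" for x
    unfolding pred_eq by (simp add: that mmn2_zero_eq_mmn[OF K L2 cov])
  moreover have "mmn u aX (mat s) L1 = mvn u (mat s)" if "aX = 0" for u
    unfolding that by (rule mmn_zero_eq_mvn[OF L1 s])
  ultimately show ?thesis
    using K pred_eq by (simp add: s_def r_def)
qed

end
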